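(* Let $X$ be a LOTS or a COTS, and let $M$ be a compact metric space. Then every function of bounded variation $f:X\to M$ is fragmented. Furthermore, if the interval topology of $X$ is Polish, then $f$ is of Baire class 1.
   Context: A LOTS is a linearly ordered set with its interval topology (generated by the open rays). A circular order on a set $X$ is a ternary relation $R\subseteq X^3$ (write $[a,b,c]$ for $(a,b,c)\in R$) satisfying: cyclicity ($[a,b,c]\Rightarrow[b,c,a]$); asymmetry ($[a,b,c]\Rightarrow (c,b,a)\notin R$); transitivity ($[a,b,c]$ and $[a,c,d]$ imply $[a,b,d]$); totality (if $a,b,c$ are distinct then $[a,b,c]$ or $[a,c,b]$). Put $[a,b]_R:=\{x\in X:[a,x,b]\}\cup\{a,b\}$. A COTS is a circularly ordered set $(X,R)$ with its interval topology $\lambda_R$, i.e. the topology with base $\{X\setminus[a,b]_R: a,b\in X\}\cup\{X\}$. Bounded variation of a bounded function $f:X\to(M,d)$: if $X$ is linearly ordered, there is $r$ with $\sum_{i=1}^{n-1}d(f(x_i),f(x_{i+1}))\leq r$ for all $x_1<\dots<x_n$ in $X$; if $X$ is circularly ordered, there is $r$ with $\sum_{i=1}^{n}d(f(x_i),f(x_{i+1}))\leq r$ ($x_{n+1}=x_1$) for every injective cycle $[x_1,\dots,x_n]$ in $X$, i.e. every tuple of distinct points with $[x_i,x_j,x_k]$ whenever $i,j,k$ are in the standard cyclic order of $\mathbb Z/n$. A map $f:X\to(M,d)$ from a topological space to a metric space is fragmented if for every $\varepsilon>0$ and every nonempty $A\subseteq X$ there is a nonempty relatively open $O\subseteq A$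 such that $f(O)$ has diameter at most $\varepsilon$. A map $f$ is of Baire class 1 if the preimage of every open set is an $F_\sigma$ set. *)

theory Defs
  imports "HOL-Analysis.Analysis"
begin

section \<open>Linearly and circularly ordered topological spaces\<close>

text \<open>
  A linear order on \<open>X\<close> is the library's reflexive \<open>linear_order_on X r\<close>. The open rays are
  taken relative to \<open>X\<close>, so that \<open>X\<close> is the whole space even when it has at most one point.
\<close>

definition open_rays :: "'a set \<Rightarrow> 'a rel \<Rightarrow> 'a set set" where
  "open_rays X r =
     (\<lambda>a. {x \<in> X. (a, x) \<in> r \<and> x \<noteq> a}) ` X \<union> (\<lambda>a. {x \<in> X. (x, a) \<in> r \<and> x \<noteq> a}) ` X"

definition linear_interval_topology :: "'a set \<Rightarrow> 'a rel \<Rightarrow> 'a topology" where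
  "linear_interval_topology X r =
     topology (arbitrary union_of (finite intersection_of (\<lambda>U. U \<in> open_rays X r) relative_to X))"

definition circular_order_on :: "'a set \<Rightarrow> ('a \<times> 'a \<times> 'a) set \<Rightarrow> bool" where
  "circular_order_on X R \<longleftrightarrow>
     R \<subseteq> X \<times> X \<times> X \<and>
     (\<forall>a b c. (a, b, c) \<in> R \<longrightarrow> (b, c, a) \<in> R) \<and>
     (\<forall>a b c. (a, b, c) \<in> R \<longrightarrow> (c, b, a) \<notin> R) \<and>
     (\<forall>a b c d. (a, b, c) \<in> R \<and> (a, c, d) \<in> R \<longrightarrow> (a, b, d) \<in> R) \<and>
     (\<forall>a\<in>X. \<forall>b\<in>X. \<forall>c\<in>X. a \<noteq> b \<and> b \<noteq> c \<and> a \<noteq> c \<longrightarrow> (a, b, c) \<in> R \<or> (a, c, b) \<in> R)"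

definition circular_interval :: "'a set \<Rightarrow> ('a \<times> 'a \<times> 'a) set \<Rightarrow> 'a \<Rightarrow> 'a \<Rightarrow> 'a set" where
  "circular_interval X R a b = {x \<in> X. (a, x, b) \<in> R} \<union> {a, b}"

definition circular_base :: "'a set \<Rightarrow> ('a \<times> 'a \<times> 'a) set \<Rightarrow> 'a set set" where
  "circular_base X R = insert X {X - circular_interval X R a b | a b. a \<in> X \<and> b \<in> X}"

definition circular_interval_topology :: "'a set \<Rightarrow> ('a \<times> 'a \<times> 'a) set \<Rightarrow> 'a topology" where
  "circular_interval_topology X R = topology (arbitrary union_of (\<lambda>U. U \<in> circular_base X R))"

text \<open>
  The function \<open>topology\<close> is only meaningful on families satisfying \<open>istopology\<close>; the following
  lemmas check this, and that the underlying set is \<open>X\<close>, in both cases.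
\<close>

lemma openin_linear_interval_topology:
  "openin (linear_interval_topology X r) =
     arbitrary union_of (finite intersection_of (\<lambda>U. U \<in> open_rays X r) relative_to X)"
  unfolding linear_interval_topology_def by (simp add: istopology_subbase topology_inverse')

lemma topspace_linear_interval_topology [simp]: "topspace (linear_interval_topology X r) = X"
  unfolding linear_interval_topology_def by simp

lemma circular_base_Int:
  assumes R: "circular_order_on X R"
    and U: "U \<in> circular_base X R" and V: "V \<in> circular_base X R" and x: "x \<in> U" "x \<in> V"
  shows "\<exists>W \<in> circular_base X R. x \<in> W \<and> W \<subseteq> U \<inter> V"
proof -
  note D = R[unfolded circular_order_on_def]
  have sub: "a \<in> X \<and> b \<in> X \<and> c \<in> X" if "(a, b, c) \<in> R" for a b c
    using conjunct1[OF D] that by blast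
  have cyc: "(b, c, a) \<in> R" if "(a, b, c) \<in> R" for a b c
    using conjunct1[OF conjunct2[OF D]] that by simp
  have asym: "(c, b, a) \<notin> R" if "(a, b, c) \<in> R" for a b c
    using conjunct1[OF conjunct2[OF conjunct2[OF D]]] that by simp
  have tr: "(a, b, d) \<in> R" if "(a, b, c) \<in> R" "(a, c, d) \<in> R" for a b c d
    using conjunct1[OF conjunct2[OF conjunct2[OF conjunct2[OF D]]]] that by metis
  have tot: "(a, b, c) \<in> R \<or> (a, c, b) \<in> R"
    if "a \<in> X" "b \<in> X" "c \<in> X" "a \<noteq> b" "b \<noteq> c" "a \<noteq> c" for a b c
    using conjunct2[OF conjunct2[OF conjunct2[OF conjunct2[OF D]]]] that by simp
  have ne: "a \<noteq> b \<and> b \<noteq> c \<and> a \<noteq> c" if "(a, b, c) \<in> R" for a b c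
    using that cyc asym by metis
  have single: "X - circular_interval X R a a = X - {a}" for a
    using ne by (auto simp: circular_interval_def)
  have arc: "X - circular_interval X R b a = {x. (a, x, b) \<in> R}" if "a \<in> X" "b \<in> X" "a \<noteq> b" for a b
  proof -
    have "x \<noteq> a \<and> x \<noteq> b \<and> (b, x, a) \<notin> R \<longleftrightarrow> (a, x, b) \<in> R" if "x \<in> X" for x
      using ne asym cyc tot[of a x b] that \<open>a \<in> X\<close> \<open>b \<in> X\<close> \<open>a \<noteq> b\<close> by metis
    then show ?thesis
      using sub unfolding circular_interval_def by blast
  qed
  have cases: "P" if "B \<in> circular_base X R" "B = X \<Longrightarrow> P" "\<And>a. a \<in> X \<Longrightarrow> B = X - {a} \<Longrightarrow> P"
      "\<And>a b. a \<in> X \<Longrightarrow> b \<in> X \<Longrightarrow> a \<noteq> b \<Longrightarrow> B = {x. (a, x, b) \<in> R} \<Longrightarrow> P" for B P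
    using that single arc unfolding circular_base_def by (smt (verit) insertE mem_Collect_eq)
  have baseS: "X - {a} \<in> circular_base X R" if "a \<in> X" for a
    using that single[of a] unfolding circular_base_def by blast
  have baseA: "{x. (a, x, b) \<in> R} \<in> circular_base X R" if "a \<in> X" "b \<in> X" "a \<noteq> b" for a b
    using that arc[of a b] unfolding circular_base_def by blast
  have arcW: ?thesis if "(a, x, b) \<in> R" "{x. (a, x, b) \<in> R} \<subseteq> U \<inter> V" for a b
    using that(2) baseA[of a b] sub[OF that(1)] ne[OF that(1)] that(1)
    by (intro bexI[of _ "{x. (a, x, b) \<in> R}"]) simp_all
  have UX: "U \<subseteq> X" and VX: "V \<subseteq> X"
    using U V unfolding circular_base_def by auto
  have mixed: "\<exists>p q. (p, x, q) \<in> R \<and> {x. (p, x, q) \<in> R} \<subseteq> (X - {a}) \<inter> {x. (c, x, d) \<in> R}"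
    if m: "a \<in> X" "x \<noteq> a" "(c, x, d) \<in> R" for a c d
  proof (cases "(c, a, d) \<in> R")
    case False
    then show ?thesis using that sub by blast
  next
    case True
    consider "(c, x, a) \<in> R" | "(c, a, x) \<in> R"
      using tot[of c x a] sub[OF m(3)] ne[OF m(3)] ne[OF True] m(1,2) by metis
    then show ?thesis
    proof cases
      case 1
      have "{x. (c, x, a) \<in> R} \<subseteq> (X - {a}) \<inter> {x. (c, x, d) \<in> R}"
        using tr True sub ne by blast
      with 1 show ?thesis by blast
    next
      case 2
      have "(a, x, d) \<in> R" using 2 that cyc tr by meson
      moreover have "{x. (a, x, d) \<in> R} \<subseteq> (X - {a}) \<inter> {x. (c, x, d) \<in> R}"
      proof
        fix y assume "y \<in> {x. (a, x, d) \<in> R}"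
        then have y: "(a, y, d) \<in> R" by simp
        then have "(c, y, d) \<in> R" using True cyc tr by meson
        then show "y \<in> (X - {a}) \<inter> {x. (c, x, d) \<in> R}" using y sub ne by blast
      qed
      ultimately show ?thesis by blast
    qed
  qed
  show ?thesis
  proof (rule cases[OF U])
    assume "U = X" then show ?thesis using V VX x by blast
  next
    fix a assume a: "a \<in> X" "U = X - {a}"
    show ?thesis
    proof (rule cases[OF V])
      assume "V = X" then show ?thesis using U UX x by blast
    next
      fix c assume c: "c \<in> X" "V = X - {c}"
      show ?thesis
      proof (cases "a = c")
        case True
        then have "U \<inter> V = U" using a c by simp
        then show ?thesis using U x by (intro bexI[of _ U]) simp_all
      next
        case False
        then have "(a, x, c) \<in> R \<or> (c, x, a) \<in> R"
          using tot[of a x c] cyc a c x by blast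
        moreover have "(y \<in> U \<inter> V)" if "(a, y, c) \<in> R \<or> (c, y, a) \<in> R" for y
          using that sub ne unfolding a(2) c(2) by (metis Diff_iff IntI singletonD)
        ultimately show ?thesis
          using arcW[of a c] arcW[of c a] by (metis (no_types, lifting) mem_Collect_eq subsetI)
      qed
    next
      fix c d assume "V = {x. (c, x, d) \<in> R}"
      then show ?thesis using mixed[of a c d] a x arcW by blast
    qed
  next
    fix a b assume ab: "a \<noteq> b" "U = {x. (a, x, b) \<in> R}"
    show ?thesis
    proof (rule cases[OF V])
      assume "V = X" then show ?thesis using U UX x by blast
    next
      fix c assume "c \<in> X" "V = X - {c}"
      then show ?thesis using mixed[of c a b] ab x arcW by blast
    next
      fix c d assume cd: "V = {x. (c, x, d) \<in> R}"
      have ax: "(a, x, b) \<in> R" and cx: "(c, x, d) \<in> R" using ab cd x by auto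
      obtain p where p: "(p, x, b) \<in> R" "p = c \<or> (c, p, x) \<in> R"
        "{x. (p, x, b) \<in> R} \<subseteq> {x. (a, x, b) \<in> R}"
      proof (cases "a = c \<or> (c, a, x) \<in> R")
        case True then show ?thesis using that ax by blast
      next
        case False
        then have 1: "(c, x, a) \<in> R" using tot[of c x a] ne ax cx sub by blast
        then have 2: "(a, c, x) \<in> R" using cyc by blast
        then have 3: "(a, c, b) \<in> R" using ax tr by blast
        have "(c, x, b) \<in> R" using 2 ax cyc tr by meson
        moreover have "{x. (c, x, b) \<in> R} \<subseteq> {x. (a, x, b) \<in> R}"
          using 3 cyc tr by (smt (verit) mem_Collect_eq subsetI)
        ultimately show ?thesis using that by blast
      qed
      obtain q where q: "(p, x, q) \<in> R" "q = d \<or> (x, q, d) \<in> R"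
        "{x. (p, x, q) \<in> R} \<subseteq> {x. (p, x, b) \<in> R}"
      proof (cases "b = d \<or> (x, b, d) \<in> R")
        case True then show ?thesis using that p by blast
      next
        case False
        then have 1: "(x, d, b) \<in> R" using tot[of x b d] ne ax cx sub by blast
        then have 2: "(b, x, d) \<in> R" using cyc by blast
        have bp: "(b, p, x) \<in> R" using p cyc by blast
        have bpd: "(b, p, d) \<in> R" using bp 2 tr by blast
        have pxd: "(p, x, d) \<in> R" using bp 2 cyc tr by meson
        have "(p, d, b) \<in> R" using bpd cyc by blast
        then have "{x. (p, x, d) \<in> R} \<subseteq> {x. (p, x, b) \<in> R}" using tr by blast
        then show ?thesis using that pxd by blast
      qed
      have pxd: "(p, x, d) \<in> R"
        using p(2) cx cyc tr by meson
      have "(p, y, d) \<in> R" if y: "(p, y, q) \<in> R" for y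
      proof (cases "q = d")
        case False
        then have "(x, q, d) \<in> R" using q by blast
        then have "(p, q, d) \<in> R" using q(1) pxd cyc tr by meson
        then show ?thesis using y tr by blast
      qed (use y in simp)
      moreover have "(c, y, d) \<in> R" if y: "(p, y, d) \<in> R" for y
      proof (cases "p = c")
        case False
        then have "(c, p, x) \<in> R" using p by blast
        then have "(c, p, d) \<in> R" using cx tr by blast
        then show ?thesis using y cyc tr by meson
      qed (use y in simp)
      ultimately have "{x. (p, x, q) \<in> R} \<subseteq> U \<inter> V" using ab cd p q by blast
      then show ?thesis using arcW q(1) by blast
    qed
  qed
qed

lemma openin_circular_interval_topology:
  assumes "circular_order_on X R"
  shows "openin (circular_interval_topology X R) = arbitrary union_of (\<lambda>U. U \<in> circular_base X R)"
proof -
  have "istopology (arbitrary union_of (\<lambda>U. U \<in> circular_base X R))"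
    unfolding istopology_base_eq
  proof (intro allI impI)
    fix S T assume ST: "S \<in> circular_base X R \<and> T \<in> circular_base X R"
    have "S \<inter> T = \<Union>{W \<in> circular_base X R. W \<subseteq> S \<inter> T}"
      using circular_base_Int[OF assms] ST by blast
    then show "(arbitrary union_of (\<lambda>U. U \<in> circular_base X R)) (S \<inter> T)"
      unfolding union_of_def arbitrary_def by (metis (mono_tags, lifting) mem_Collect_eq subsetI)
  qed
  then show ?thesis
    unfolding circular_interval_topology_def by (simp add: topology_inverse')
qed

lemma topspace_circular_interval_topology:
  assumes "circular_order_on X R"
  shows "topspace (circular_interval_topology X R) = X"
proof (rule antisym)
  have "S \<subseteq> X" if "S \<in> circular_base X R" for S
    using that unfolding circular_base_def by auto
  then show "topspace (circular_interval_topology X R) \<subseteq> X"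
    unfolding topspace_def openin_circular_interval_topology[OF assms] union_of_def by auto
  have "openin (circular_interval_topology X R) X"
    unfolding openin_circular_interval_topology[OF assms]
    by (rule union_of_inc) (simp_all add: arbitrary_def circular_base_def)
  then show "X \<subseteq> topspace (circular_interval_topology X R)"
    by (rule openin_subset)
qed


section \<open>Bounded variation\<close>

definition linear_BV :: "'a set \<Rightarrow> 'a rel \<Rightarrow> ('a \<Rightarrow> 'b::metric_space) \<Rightarrow> bool" where
  "linear_BV X r f \<longleftrightarrow> bounded (f ` X) \<and>
     (\<exists>c. \<forall>xs. set xs \<subseteq> X \<and> sorted_wrt (\<lambda>x y. (x, y) \<in> r \<and> x \<noteq> y) xs \<longrightarrow>
        (\<Sum>i<length xs - 1. dist (f (xs ! i)) (f (xs ! Suc i))) \<le> c)"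

definition injective_cycle :: "'a set \<Rightarrow> ('a \<times> 'a \<times> 'a) set \<Rightarrow> 'a list \<Rightarrow> bool" where
  "injective_cycle X R xs \<longleftrightarrow> set xs \<subseteq> X \<and> distinct xs \<and>
     (\<forall>i<length xs. \<forall>j<length xs. \<forall>k<length xs.
        (i < j \<and> j < k) \<or> (j < k \<and> k < i) \<or> (k < i \<and> i < j) \<longrightarrow> (xs ! i, xs ! j, xs ! k) \<in> R)"

definition circular_BV ::
    "'a set \<Rightarrow> ('a \<times> 'a \<times> 'a) set \<Rightarrow> ('a \<Rightarrow> 'b::metric_space) \<Rightarrow> bool" where
  "circular_BV X R f \<longleftrightarrow> bounded (f ` X) \<and>
     (\<exists>c. \<forall>xs. injective_cycle X R xs \<longrightarrow>
        (\<Sum>i<length xs. dist (f (xs ! i)) (f (xs ! (Suc i mod length xs)))) \<le> c)"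


section \<open>Fragmented maps, Baire class 1, Polish topologies\<close>

text \<open>
  Boundedness is required explicitly because \<open>diameter\<close> is unspecified on unbounded sets.
\<close>

definition fragmented_map :: "'a topology \<Rightarrow> ('a \<Rightarrow> 'b::metric_space) \<Rightarrow> bool" where
  "fragmented_map T f \<longleftrightarrow>
     (\<forall>\<epsilon>>0. \<forall>A. A \<subseteq> topspace T \<and> A \<noteq> {} \<longrightarrow>
        (\<exists>U. openin (subtopology T A) U \<and> U \<noteq> {} \<and> bounded (f ` U) \<and> diameter (f ` U) \<le> \<epsilon>))"

definition baire_class_1 :: "'a topology \<Rightarrow> 'b::metric_space set \<Rightarrow> ('a \<Rightarrow> 'b) \<Rightarrow> bool" where
  "baire_class_1 T M f \<longleftrightarrow>
     (\<forall>V. openin (top_of_set M) V \<longrightarrow> fsigma_in T {x \<in> topspace T. f x \<in> V})"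

definition Polish_topology :: "'a topology \<Rightarrow> bool" where
  "Polish_topology T \<longleftrightarrow> completely_metrizable_space T \<and> separable_space T"

end

theory Submission
  imports Defs
begin

text \<open>
  Suppose that \<open>f\<close> oscillates by more than \<open>\<epsilon>\<close> on every nonempty relatively open part of \<open>A\<close>.
  Such a part has two points \<open>p < q\<close>, and its points below \<open>q\<close> again contain a pair with large
  oscillation, leaving a nonempty open part above that pair. Stacking such pairs upwards gives
  chains of arbitrarily large variation. A circular order reduces to this case by cutting at a
  point \<open>p\<close> of \<open>A\<close>: away from \<open>p\<close>, the open rays of the cut order are open arcs ending at \<open>p\<close>.

  For the Baire class, second countability turns fragmentability into countable covers of the
  space by \<open>F\<^sub>\<sigma>\<close> sets on which \<open>f\<close> oscillates by at most \<open>\<epsilon>\<close>; the preimage of an open set is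
  the union, over \<open>\<epsilon> = 1/n\<close>, of those members of the covers that lie in it.
\<close>

section \<open>Large oscillation forces long chains\<close>

text \<open>Induction on \<open>n\<close>: the pair \<open>x\<close>, \<open>y\<close> is put in
  front of a chain from the ray above \<open>y\<close>. The third point \<open>z\<close> in
  \<open>osc\<close> keeps that ray nonempty. Admitting both \<open>A\<close> and its upper rays as
  \<open>B\<close> lets the induction hypothesis apply to the ray.\<close>

lemma long_chain_of_oscillation:
  fixes f :: "'a \<Rightarrow> 'b::metric_space" and lt :: "'a \<Rightarrow> 'a \<Rightarrow> bool"
  assumes trans: "\<And>x y z. lt x y \<Longrightarrow> lt y z \<Longrightarrow> lt x z"
    and osc: "\<And>B. B = A \<or> (\<exists>b\<in>A. B = {x \<in> A. lt b x}) \<Longrightarrow> B \<noteq> {} \<Longrightarrow>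
      \<exists>x\<in>B. \<exists>y\<in>B. \<exists>z\<in>B. lt x y \<and> lt y z \<and> \<epsilon> \<le> dist (f x) (f y)"
    and B: "B = A \<or> (\<exists>b\<in>A. B = {x \<in> A. lt b x})" "B \<noteq> {}"
  shows "\<exists>xs. set xs \<subseteq> B \<and> sorted_wrt lt xs \<and>
    real n * \<epsilon> \<le> (\<Sum>i<length xs - 1. dist (f (xs ! i)) (f (xs ! Suc i)))"
  using B
proof (induction n arbitrary: B)
  case 0
  show ?case by (rule exI[of _ "[]"]) simp
next
  case (Suc n)
  obtain x y z where xyz: "x \<in> B" "y \<in> B" "z \<in> B" "lt x y" "lt y z" "\<epsilon> \<le> dist (f x) (f y)"
    using osc[OF Suc.prems] by blast
  \<comment> \<open>\<open>B\<close> is upward closed in \<open>A\<close>, so the chain found above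
    \<open>y\<close> stays in \<open>B\<close>.\<close>
  have up: "w \<in> B" if "w \<in> A" "lt y w" for w
    using Suc.prems(1)
  proof (elim disjE bexE)
    fix b assume b: "B = {x \<in> A. lt b x}"
    then have "lt b w" using xyz(2) that(2) trans[of b y w] by blast
    then show ?thesis using b that(1) by blast
  qed (use that in blast)
  have BA: "B \<subseteq> A" using Suc.prems by blast
  define C where "C = {w \<in> A. lt y w}"
  have "C = A \<or> (\<exists>b\<in>A. C = {x \<in> A. lt b x})" "C \<noteq> {}"
    using xyz BA by (auto simp: C_def)
  then obtain xs where xs: "set xs \<subseteq> C" "sorted_wrt lt xs"
    "real n * \<epsilon> \<le> (\<Sum>i<length xs - 1. dist (f (xs ! i)) (f (xs ! Suc i)))"
    using Suc.IH by blast
  have "set (x # y # xs) \<subseteq> B"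
    using xs(1) xyz up by (auto simp: C_def)
  moreover have "sorted_wrt lt (x # y # xs)"
    using xs(1,2) xyz(4) by (auto simp: C_def intro: trans)
  \<comment> \<open>The link from \<open>y\<close> to the head of \<open>xs\<close> is dropped as a
    nonnegative term. If \<open>xs\<close> is empty, the truncated \<open>length xs - 1\<close>
    makes its sum empty.\<close>
  moreover have "dist (f x) (f y) + (\<Sum>i<length xs - 1. dist (f (xs ! i)) (f (xs ! Suc i)))
      \<le> (\<Sum>i<length (x # y # xs) - 1. dist (f ((x # y # xs) ! i)) (f ((x # y # xs) ! Suc i)))"
    by (cases xs) (simp_all add: sum.lessThan_Suc_shift del: sum.lessThan_Suc)
  ultimately show ?case
    using xyz(6) xs(3) by (intro exI[of _ "x # y # xs"]) (simp add: algebra_simps)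
qed

text \<open>An abstract relation \<open>lt\<close>, with rays open only relative to
  \<open>A\<close>, lets the same argument serve a linear order and a circular order cut at a
  point.\<close>

lemma small_oscillation_on_open_part:
  fixes f :: "'a \<Rightarrow> 'b::metric_space" and lt :: "'a \<Rightarrow> 'a \<Rightarrow> bool"
  assumes A: "A \<subseteq> topspace T" "A \<noteq> {}"
    and trans: "\<And>x y z. lt x y \<Longrightarrow> lt y z \<Longrightarrow> lt x z"
    and total: "\<And>x y. x \<in> A \<Longrightarrow> y \<in> A \<Longrightarrow> x \<noteq> y \<Longrightarrow> lt x y \<or> lt y x"
    and up: "\<And>b. b \<in> A \<Longrightarrow> openin (subtopology T A) {x \<in> A. lt b x}"
    and down: "\<And>b. b \<in> A \<Longrightarrow> openin (subtopology T A) {x \<in> A. lt x b}"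
    and bdd: "bounded (f ` A)"
    and var: "\<And>xs. set xs \<subseteq> A \<Longrightarrow> sorted_wrt lt xs \<Longrightarrow>
      (\<Sum>i<length xs - 1. dist (f (xs ! i)) (f (xs ! Suc i))) \<le> c"
    and "\<epsilon> > 0"
  shows "\<exists>U. openin (subtopology T A) U \<and> U \<noteq> {} \<and> bounded (f ` U) \<and> diameter (f ` U) \<le> \<epsilon>"
proof (rule ccontr)
  assume contr: "\<not> ?thesis"
  have pair: "\<exists>x\<in>U. \<exists>y\<in>U. lt x y \<and> \<epsilon> \<le> dist (f x) (f y)"
    if U: "openin (subtopology T A) U" "U \<noteq> {}" for U
  proof (rule ccontr)
    assume no: "\<not> ?thesis"
    have UA: "U \<subseteq> A"
      using openin_subset[OF U(1)] by simp
    have "dist (f x) (f y) \<le> \<epsilon>" if "x \<in> U" "y \<in> U" for x y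
    proof (cases "x = y")
      case False
      then have "lt x y \<or> lt y x" using total that UA by blast
      then show ?thesis using no that by (metis dist_commute linorder_le_cases)
    qed (use \<open>\<epsilon> > 0\<close> in simp)
    then have "diameter (f ` U) \<le> \<epsilon>"
      using U(2) by (auto simp: diameter_def intro!: cSUP_least)
    moreover have "bounded (f ` U)"
      using bdd UA by (meson bounded_subset image_mono)
    ultimately show False using contr U by blast
  qed
  have osc: "\<exists>x\<in>B. \<exists>y\<in>B. \<exists>z\<in>B. lt x y \<and> lt y z \<and> \<epsilon> \<le> dist (f x) (f y)"
    if B: "B = A \<or> (\<exists>b\<in>A. B = {x \<in> A. lt b x})" "B \<noteq> {}" for B
  proof -
    have opB: "openin (subtopology T A) B"
      using B(1) up A(1) by (metis inf.absorb2 openin_topspace topspace_subtopology)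
    then obtain p q where pq: "p \<in> B" "q \<in> B" "lt p q"
      using pair B(2) by blast
    have BA: "B \<subseteq> A" using B by blast
    \<comment> \<open>\<open>p\<close> makes this open set nonempty, and \<open>q\<close> lies above
      every pair found in it, so \<open>q\<close> serves as the third point.\<close>
    have "openin (subtopology T A) (B \<inter> {x \<in> A. lt x q})"
      using opB down pq BA by blast
    then obtain x y where "x \<in> B" "y \<in> B" "lt x y" "lt y q" "\<epsilon> \<le> dist (f x) (f y)"
      using pair[of "B \<inter> {x \<in> A. lt x q}"] pq BA by blast
    then show ?thesis using pq by blast
  qed
  obtain n :: nat where n: "c < real n * \<epsilon>"
    using ex_less_of_nat_mult[OF \<open>\<epsilon> > 0\<close>] by blast
  obtain xs where "set xs \<subseteq> A" "sorted_wrt lt xs"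
    "real n * \<epsilon> \<le> (\<Sum>i<length xs - 1. dist (f (xs ! i)) (f (xs ! Suc i)))"
  proof -
    have "\<exists>xs. set xs \<subseteq> A \<and> sorted_wrt lt xs \<and>
        real n * \<epsilon> \<le> (\<Sum>i<length xs - 1. dist (f (xs ! i)) (f (xs ! Suc i)))"
      by (rule long_chain_of_oscillation[where A = A]) (fact trans osc A(2) | simp)+
    with that show ?thesis by blast
  qed
  then show False using var n by fastforce
qed

section \<open>Linear orders\<close>

lemma linear_BV_imp_fragmented:
  fixes f :: "'a \<Rightarrow> 'b::metric_space"
  assumes r: "linear_order_on X r" and f: "linear_BV X r f"
  shows "fragmented_map (linear_interval_topology X r) f"
  unfolding fragmented_map_def
proof (intro allI impI)
  let ?T = "linear_interval_topology X r" and ?lt = "\<lambda>x y. (x, y) \<in> r \<and> x \<noteq> y"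
  fix \<epsilon> :: real and A assume "\<epsilon> > 0" and "A \<subseteq> topspace ?T \<and> A \<noteq> {}"
  then have A: "A \<subseteq> X" "A \<noteq> {}" by auto
  have tr: "trans r" and anti: "antisym r" and tot: "total_on X r"
    using r by (auto simp: order_on_defs)
  obtain c where c: "\<And>xs. set xs \<subseteq> X \<Longrightarrow> sorted_wrt ?lt xs \<Longrightarrow>
      (\<Sum>i<length xs - 1. dist (f (xs ! i)) (f (xs ! Suc i))) \<le> c"
    using f unfolding linear_BV_def by blast
  have ray: "openin (subtopology ?T A) (A \<inter> U)" if "U \<in> open_rays X r" for U
  proof -
    have "U \<subseteq> X" using that by (auto simp: open_rays_def)
    then have "(finite intersection_of (\<lambda>U. U \<in> open_rays X r) relative_to X) U"
      using relative_to_subset_inc finite_intersection_of_inc that by metis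
    then have "openin ?T U"
      unfolding openin_linear_interval_topology by (rule arbitrary_union_of_inc)
    then show ?thesis by (simp add: openin_subtopology_Int2)
  qed
  show "\<exists>U. openin (subtopology ?T A) U \<and> U \<noteq> {} \<and> bounded (f ` U) \<and> diameter (f ` U) \<le> \<epsilon>"
  proof (rule small_oscillation_on_open_part[where lt = ?lt and c = c])
    show "?lt x z" if "?lt x y" "?lt y z" for x y z
      using that transD[OF tr, of x y z] antisymD[OF anti, of y x] by blast
    show "?lt x y \<or> ?lt y x" if "x \<in> A" "y \<in> A" "x \<noteq> y" for x y
      using that A tot by (auto simp: total_on_def)
  next
    fix b assume "b \<in> A"
    then have "{x \<in> X. (b, x) \<in> r \<and> x \<noteq> b} \<in> open_rays X r" "{x \<in> X. (x, b) \<in> r \<and> x \<noteq> b} \<in> open_rays X r"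
      using A by (auto simp: open_rays_def)
    moreover have "{x \<in> A. ?lt b x} = A \<inter> {x \<in> X. (b, x) \<in> r \<and> x \<noteq> b}"
      "{x \<in> A. ?lt x b} = A \<inter> {x \<in> X. (x, b) \<in> r \<and> x \<noteq> b}"
      using A by auto
    ultimately show "openin (subtopology ?T A) {x \<in> A. ?lt b x}"
      "openin (subtopology ?T A) {x \<in> A. ?lt x b}"
      by (simp_all only: ray)
  next
    show "bounded (f ` A)"
      using f A unfolding linear_BV_def by (meson bounded_subset image_mono)
  qed (use A c \<open>\<epsilon> > 0\<close> in auto)
qed

section \<open>Circular orders, cut at a point\<close>

lemma circular_order_onD:
  assumes "circular_order_on X R"
  shows circular_order_on_subset: "(a, b, c) \<in> R \<Longrightarrow> a \<in> X \<and> b \<in> X \<and> c \<in> X"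
    and circular_order_on_cyclic: "(a, b, c) \<in> R \<Longrightarrow> (b, c, a) \<in> R"
    and circular_order_on_asym: "(a, b, c) \<in> R \<Longrightarrow> (c, b, a) \<notin> R"
    and circular_order_on_trans: "(a, b, c) \<in> R \<Longrightarrow> (a, c, d) \<in> R \<Longrightarrow> (a, b, d) \<in> R"
    and circular_order_on_total: "a \<in> X \<Longrightarrow> b \<in> X \<Longrightarrow> c \<in> X \<Longrightarrow> a \<noteq> b \<Longrightarrow> b \<noteq> c \<Longrightarrow> a \<noteq> c \<Longrightarrow>
      (a, b, c) \<in> R \<or> (a, c, b) \<in> R"
proof -
  note D = assms[unfolded circular_order_on_def]
  show "(a, b, c) \<in> R \<Longrightarrow> a \<in> X \<and> b \<in> X \<and> c \<in> X"
    using conjunct1[OF D] by blast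
  show "(a, b, c) \<in> R \<Longrightarrow> (b, c, a) \<in> R"
    using conjunct1[OF conjunct2[OF D]] by simp
  show "(a, b, c) \<in> R \<Longrightarrow> (c, b, a) \<notin> R"
    using conjunct1[OF conjunct2[OF conjunct2[OF D]]] by simp
  show "(a, b, c) \<in> R \<Longrightarrow> (a, c, d) \<in> R \<Longrightarrow> (a, b, d) \<in> R"
    using conjunct1[OF conjunct2[OF conjunct2[OF conjunct2[OF D]]]] by metis
  show "a \<in> X \<Longrightarrow> b \<in> X \<Longrightarrow> c \<in> X \<Longrightarrow> a \<noteq> b \<Longrightarrow> b \<noteq> c \<Longrightarrow> a \<noteq> c \<Longrightarrow>
      (a, b, c) \<in> R \<or> (a, c, b) \<in> R"
    using conjunct2[OF conjunct2[OF conjunct2[OF conjunct2[OF D]]]] by simp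
qed

text \<open>The arc is the complement of the closed interval read the other way, from
  \<open>b\<close> to \<open>a\<close>: a point other than \<open>a\<close> and \<open>b\<close>
  lies on exactly one of the two arcs.\<close>

lemma openin_circular_arc:
  assumes R: "circular_order_on X R" and "a \<in> X" "b \<in> X" "a \<noteq> b"
  shows "openin (circular_interval_topology X R) {x. (a, x, b) \<in> R}"
proof -
  note sub = circular_order_on_subset[OF R] and cyc = circular_order_on_cyclic[OF R]
    and asym = circular_order_on_asym[OF R] and tot = circular_order_on_total[OF R]
  have ne: "a \<noteq> b \<and> b \<noteq> c \<and> a \<noteq> c" if "(a, b, c) \<in> R" for a b c
    using that cyc asym by metis
  have "x \<noteq> a \<and> x \<noteq> b \<and> (b, x, a) \<notin> R \<longleftrightarrow> (a, x, b) \<in> R" if "x \<in> X" for x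
    using ne asym cyc tot[of a x b] that assms(2-4) by metis
  then have "{x. (a, x, b) \<in> R} = X - circular_interval X R b a"
    using sub unfolding circular_interval_def by blast
  then have "{x. (a, x, b) \<in> R} \<in> circular_base X R"
    using assms by (auto simp: circular_base_def)
  then show ?thesis
    unfolding openin_circular_interval_topology[OF R] by (rule arbitrary_union_of_inc)
qed

text \<open>The interval from \<open>a\<close> to \<open>a\<close> degenerates to a point, since a
  triple \<open>(a, x, a)\<close> is its own reversal. This makes \<open>A\<close> without its cut
  point relatively open in \<open>A\<close>.\<close>

lemma openin_circular_delete_point:
  assumes R: "circular_order_on X R" and "a \<in> X"
  shows "openin (circular_interval_topology X R) (X - {a})"
proof -
  have "(a, x, a) \<notin> R" for x
    using circular_order_on_cyclic[OF R] circular_order_on_asym[OF R] by blast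
  then have "X - {a} = X - circular_interval X R a a"
    by (auto simp: circular_interval_def)
  then have "X - {a} \<in> circular_base X R"
    using assms by (auto simp: circular_base_def)
  then show ?thesis
    unfolding openin_circular_interval_topology[OF R] by (rule arbitrary_union_of_inc)
qed

text \<open>This carries the circular variation bound over to chains of the order cut at
  \<open>p\<close>.\<close>

lemma injective_cycle_cut_chain:
  assumes R: "circular_order_on X R"
    and xs: "sorted_wrt (\<lambda>x y. (p, x, y) \<in> R) xs" "set xs \<subseteq> X"
  shows "injective_cycle X R xs"
proof -
  note cyc = circular_order_on_cyclic[OF R] and asym = circular_order_on_asym[OF R]
    and tr = circular_order_on_trans[OF R]
  have lt: "(p, xs ! i, xs ! j) \<in> R" if "i < j" "j < length xs" for i j
    using xs(1) that by (simp add: sorted_wrt_iff_nth_less)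
  have up: "(xs ! i, xs ! j, xs ! k) \<in> R" if "i < j" "j < k" "k < length xs" for i j k
  proof -
    have "(p, xs ! i, xs ! j) \<in> R" "(p, xs ! j, xs ! k) \<in> R"
      using lt that by auto
    \<comment> \<open>Rotate both triples to begin with \<open>xs ! j\<close> and apply transitivity
      there, through \<open>p\<close>.\<close>
    then have "(xs ! j, xs ! k, xs ! i) \<in> R" using cyc tr by meson
    then show ?thesis using cyc by blast
  qed
  have "(x, y, y) \<notin> R" for x y
    using cyc asym by blast
  then have "xs ! i \<noteq> xs ! j" if "i < j" "j < length xs" for i j
    using lt[OF that] by auto
  then have "distinct xs"
    unfolding distinct_conv_nth by (metis linorder_neqE_nat)
  \<comment> \<open>Each of the three index patterns is a rotation of an increasing one.\<close>
  moreover have "(xs ! i, xs ! j, xs ! k) \<in> R"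
    if "i < length xs" "j < length xs" "k < length xs"
      "(i < j \<and> j < k) \<or> (j < k \<and> k < i) \<or> (k < i \<and> i < j)" for i j k
    using that up[of i j k] up[of j k i] up[of k i j] cyc by blast
  ultimately show ?thesis
    using xs(2) unfolding injective_cycle_def by blast
qed

text \<open>The cut order is total only away from \<open>p\<close>, so the linear argument is run on
  \<open>A'\<close>, and the open part it yields is open in \<open>A\<close> because
  \<open>A'\<close> is.\<close>

lemma circular_BV_imp_fragmented:
  fixes f :: "'a \<Rightarrow> 'b::metric_space"
  assumes R: "circular_order_on X R" and f: "circular_BV X R f"
  shows "fragmented_map (circular_interval_topology X R) f"
  unfolding fragmented_map_def
proof (intro allI impI)
  let ?T = "circular_interval_topology X R"
  fix \<epsilon> :: real and A assume "\<epsilon> > 0" and "A \<subseteq> topspace ?T \<and> A \<noteq> {}"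
  then have A: "A \<subseteq> X" "A \<noteq> {}"
    by (auto simp: topspace_circular_interval_topology[OF R])
  obtain p where p: "p \<in> A" using A by blast
  let ?lt = "\<lambda>x y. (p, x, y) \<in> R"
  show "\<exists>U. openin (subtopology ?T A) U \<and> U \<noteq> {} \<and> bounded (f ` U) \<and> diameter (f ` U) \<le> \<epsilon>"
  proof (cases "A = {p}")
    \<comment> \<open>Here deleting \<open>p\<close> would leave nothing, but \<open>A\<close>
      itself works: its image is one point.\<close>
    case True
    have "openin (subtopology ?T A) A"
      using A by (metis inf.absorb2 openin_topspace topspace_subtopology
        topspace_circular_interval_topology[OF R])
    then show ?thesis using True \<open>\<epsilon> > 0\<close> by (intro exI[of _ A]) simp
  next
    case False
    define A' where "A' = A - {p}"
    have A': "A' \<subseteq> topspace ?T" "A' \<noteq> {}" "A' \<subseteq> X"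
      using A False p by (auto simp: A'_def topspace_circular_interval_topology[OF R])
    have "A' = A \<inter> (X - {p})" using A by (auto simp: A'_def)
    then have A'_open: "openin (subtopology ?T A) A'"
      using openin_circular_delete_point[OF R] p A by (metis openin_subtopology_Int2 subsetD)
    obtain c where c: "\<And>xs. injective_cycle X R xs \<Longrightarrow>
        (\<Sum>i<length xs. dist (f (xs ! i)) (f (xs ! (Suc i mod length xs)))) \<le> c"
      using f unfolding circular_BV_def by blast
    have arc: "openin (subtopology ?T A') (A' \<inter> {x. (a, x, b) \<in> R})"
      if "a \<in> X" "b \<in> X" "a \<noteq> b" for a b
      using openin_circular_arc[OF R that] by (simp add: openin_subtopology_Int2)
    have "\<exists>U. openin (subtopology ?T A') U \<and> U \<noteq> {} \<and> bounded (f ` U) \<and> diameter (f ` U) \<le> \<epsilon>"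
    proof (rule small_oscillation_on_open_part[where lt = ?lt and c = c])
      show "?lt x z" if "?lt x y" "?lt y z" for x y z
        using circular_order_on_trans[OF R that] .
      show "?lt x y \<or> ?lt y x" if "x \<in> A'" "y \<in> A'" "x \<noteq> y" for x y
        using circular_order_on_total[OF R, of p x y] that p A unfolding A'_def by blast
    next
      fix b assume b: "b \<in> A'"
      \<comment> \<open>By rotation, the upper ray of \<open>b\<close> is the arc from
        \<open>b\<close> to \<open>p\<close>; the lower ray is the arc from \<open>p\<close> to
        \<open>b\<close>.\<close>
      have "{x \<in> A'. ?lt b x} = A' \<inter> {x. (b, x, p) \<in> R}"
        using circular_order_on_cyclic[OF R] by blast
      then show "openin (subtopology ?T A') {x \<in> A'. ?lt b x}"
        using arc[of b p] b p A unfolding A'_def by auto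
      have "{x \<in> A'. ?lt x b} = A' \<inter> {x. (p, x, b) \<in> R}"
        by blast
      then show "openin (subtopology ?T A') {x \<in> A'. ?lt x b}"
        using arc[of p b] b p A unfolding A'_def by auto
    next
      show "bounded (f ` A')"
        using f A' unfolding circular_BV_def by (meson bounded_subset image_mono)
    next
      fix xs assume xs: "set xs \<subseteq> A'" "sorted_wrt ?lt xs"
      \<comment> \<open>Before the last index the \<open>mod\<close> has no effect; the cycle sum
        only adds the nonnegative closing term.\<close>
      have "(\<Sum>i<length xs - 1. dist (f (xs ! i)) (f (xs ! Suc i)))
          = (\<Sum>i<length xs - 1. dist (f (xs ! i)) (f (xs ! (Suc i mod length xs))))"
        by (intro sum.cong) auto
      also have "\<dots> \<le> (\<Sum>i<length xs. dist (f (xs ! i)) (f (xs ! (Suc i mod length xs))))"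
        by (intro sum_mono2) auto
      also have "\<dots> \<le> c"
        using xs A' by (intro c injective_cycle_cut_chain[OF R]) auto
      finally show "(\<Sum>i<length xs - 1. dist (f (xs ! i)) (f (xs ! Suc i))) \<le> c" .
    qed (use A' \<open>\<epsilon> > 0\<close> in auto)
    moreover have "openin (subtopology ?T A) U" if "openin (subtopology ?T A') U" for U
    proof -
      have "subtopology ?T A' = subtopology (subtopology ?T A) A'"
        by (simp add: subtopology_subtopology A'_def inf.absorb2)
      then show ?thesis using that A'_open openin_trans_full by metis
    qed
    ultimately show ?thesis by blast
  qed
qed

section \<open>Baire class 1 on Polish spaces\<close>

text \<open>The balls of radius \<open>1 / Suc n\<close> about a countable dense set form a
  base.\<close>

lemma separable_metrizable_imp_second_countable:
  assumes "metrizable_space T" "separable_space T"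
  shows "second_countable T"
proof -
  obtain M d where Md: "Metric_space M d" and T: "T = Metric_space.mtopology M d"
    using assms(1) by (auto simp: metrizable_space_def)
  interpret Metric_space M d by (rule Md)
  obtain C where C: "countable C" "C \<subseteq> M" "mtopology closure_of C = M"
    using assms(2) by (auto simp: separable_space_def T)
  define \<B> where "\<B> = (\<lambda>(c, n). mball c (1 / real (Suc n))) ` (C \<times> UNIV)"
  have "countable \<B>"
    unfolding \<B>_def using C(1) by auto
  moreover have "openin T V" if "V \<in> \<B>" for V
    using that by (auto simp: \<B>_def T)
  moreover have "\<exists>V\<in>\<B>. x \<in> V \<and> V \<subseteq> U" if U: "openin T U" "x \<in> U" for U x
  proof -
    obtain e where e: "e > 0" "mball x e \<subseteq> U" and xM: "x \<in> M"
      using U unfolding T openin_mtopology by blast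
    \<comment> \<open>Half of \<open>e\<close>: the distance from \<open>x\<close> to the centre and
      the radius about the centre must add up to less than \<open>e\<close>.\<close>
    obtain n where n: "1 / real (Suc n) < e / 2"
      using nat_approx_posE[of "e/2"] e(1) by auto
    have "x \<in> mtopology closure_of C" using C xM by simp
    then obtain c where c: "c \<in> C" "c \<in> mball x (1 / real (Suc n))"
      unfolding metric_closure_of by (auto dest!: spec[of _ "1 / real (Suc n)"] simp del: of_nat_Suc)
    have "mball c (1 / real (Suc n)) \<subseteq> mball x e"
    proof
      fix y assume y: "y \<in> mball c (1 / real (Suc n))"
      have "d x y \<le> d x c + d c y"
        using c y by (intro triangle) auto
      then show "y \<in> mball x e"
        using c y n by auto
    qed
    moreover have "x \<in> mball c (1 / real (Suc n))"
      using c by (auto simp: commute)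
    ultimately show ?thesis
      using e c(1) unfolding \<B>_def by blast
  qed
  ultimately show ?thesis
    unfolding second_countable_def by blast
qed

text \<open>An exhaustion without transfinite recursion: \<open>W\<close> is the largest open set
  with a countable cover by small sets. If its complement were nonempty, fragmentability would give
  a small relatively open piece of it, and adding that piece to a cover of \<open>W\<close> would
  enlarge \<open>W\<close>.\<close>

lemma fragmented_countable_fsigma_cover:
  fixes f :: "'a \<Rightarrow> 'b::metric_space"
  assumes T: "metrizable_space T" "second_countable T"
    and f: "fragmented_map T f" and "\<epsilon> > 0"
  shows "\<exists>\<D>. countable \<D> \<and> \<Union>\<D> = topspace T \<and>
    (\<forall>D\<in>\<D>. fsigma_in T D \<and> (\<forall>x\<in>D. \<forall>y\<in>D. dist (f x) (f y) \<le> \<epsilon>))"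
proof -
  define small where "small D \<longleftrightarrow> fsigma_in T D \<and> (\<forall>x\<in>D. \<forall>y\<in>D. dist (f x) (f y) \<le> \<epsilon>)" for D
  define coverable where "coverable W \<longleftrightarrow> (\<exists>\<D>. countable \<D> \<and> W \<subseteq> \<Union>\<D> \<and> (\<forall>D\<in>\<D>. small D))" for W
  obtain \<B> where \<B>: "countable \<B>" "\<And>V. V \<in> \<B> \<Longrightarrow> openin T V"
    "\<And>U x. openin T U \<Longrightarrow> x \<in> U \<Longrightarrow> \<exists>V\<in>\<B>. x \<in> V \<and> V \<subseteq> U"
    using T(2) unfolding second_countable_def by metis
  define W where "W = \<Union>{V \<in> \<B>. coverable V}"
  have openW: "openin T W"
    unfolding W_def using \<B>(2) by blast
  \<comment> \<open>Countability of the base enters here: one chosen cover for each coverable base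
    set, and countably many covers to unite.\<close>
  have covW: "coverable W"
  proof -
    have "\<forall>V\<in>{V \<in> \<B>. coverable V}. \<exists>\<D>. countable \<D> \<and> V \<subseteq> \<Union>\<D> \<and> (\<forall>D\<in>\<D>. small D)"
      unfolding coverable_def by blast
    from bchoice[OF this] obtain F where F: "\<And>V. V \<in> \<B> \<Longrightarrow> coverable V \<Longrightarrow>
        countable (F V) \<and> V \<subseteq> \<Union>(F V) \<and> (\<forall>D\<in>F V. small D)"
      by auto
    have "countable (\<Union>V\<in>{V \<in> \<B>. coverable V}. F V)"
    proof (rule countable_UN)
      show "countable {V \<in> \<B>. coverable V}"
        by (rule countable_subset[OF _ \<B>(1)]) blast
    qed (use F in blast)
    moreover have "W \<subseteq> \<Union>(\<Union>V\<in>{V \<in> \<B>. coverable V}. F V)"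
    proof
      fix x assume "x \<in> W"
      then obtain V where "V \<in> \<B>" "coverable V" "x \<in> V" by (auto simp: W_def)
      moreover from this obtain D where "D \<in> F V" "x \<in> D" using F[of V] by blast
      ultimately show "x \<in> \<Union>(\<Union>V\<in>{V \<in> \<B>. coverable V}. F V)" by blast
    qed
    moreover have "\<forall>D\<in>(\<Union>V\<in>{V \<in> \<B>. coverable V}. F V). small D"
      using F by blast
    ultimately show ?thesis
      unfolding coverable_def by blast
  qed
  have "topspace T - W = {}"
  proof (rule ccontr)
    let ?A = "topspace T - W"
    assume "?A \<noteq> {}"
    then obtain U where U: "openin (subtopology T ?A) U" "U \<noteq> {}" "bounded (f ` U)"
        "diameter (f ` U) \<le> \<epsilon>"
      using f \<open>\<epsilon> > 0\<close> unfolding fragmented_map_def by (meson Diff_subset)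
    obtain G where G: "openin T G" "U = G \<inter> ?A"
      using U(1) by (auto simp: openin_subtopology)
    have "fsigma_in T U"
      unfolding G(2) using G(1) openW T(1)
      by (intro fsigma_in_Int open_imp_fsigma_in closed_imp_fsigma_in) auto
    moreover have "dist (f x) (f y) \<le> \<epsilon>" if "x \<in> U" "y \<in> U" for x y
      using diameter_bounded_bound[OF U(3)] U(4) that by fastforce
    ultimately have "small U" by (simp add: small_def)
    obtain \<D> where \<D>: "countable \<D>" "W \<subseteq> \<Union>\<D>" "\<forall>D\<in>\<D>. small D"
      using covW by (auto simp: coverable_def)
    \<comment> \<open>Points of \<open>G\<close> outside \<open>W\<close> lie in \<open>U\<close>,
      so \<open>U\<close> together with a cover of \<open>W\<close> covers \<open>V\<close>.\<close>
    have covG: "coverable V" if "V \<subseteq> G" "openin T V" for V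
      unfolding coverable_def
    proof (intro exI conjI)
      show "V \<subseteq> \<Union>(insert U \<D>)"
        using that \<D>(2) G(2) openin_subset by fastforce
    qed (use \<D> \<open>small U\<close> in auto)
    obtain x where x: "x \<in> U" using U(2) by blast
    then obtain V where "V \<in> \<B>" "x \<in> V" "V \<subseteq> G"
      using \<B>(3)[OF G(1)] G(2) by blast
    then have "x \<in> W" using covG \<B>(2) unfolding W_def by blast
    then show False using x G(2) by blast
  qed
  then have W: "W = topspace T"
    using openin_subset[OF openW] by blast
  obtain \<D> where \<D>: "countable \<D>" "W \<subseteq> \<Union>\<D>" "\<forall>D\<in>\<D>. small D"
    using covW by (auto simp: coverable_def)
  moreover have "\<Union>\<D> \<subseteq> topspace T"
    using \<D>(3) fsigma_in_subset unfolding small_def by blast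
  ultimately show ?thesis
    using W unfolding small_def by (intro exI[of _ \<D>]) auto
qed

lemma fragmented_imp_baire_class_1:
  fixes f :: "'a \<Rightarrow> 'b::metric_space"
  assumes T: "metrizable_space T" "second_countable T"
    and f: "fragmented_map T f" "f \<in> topspace T \<rightarrow> M"
  shows "baire_class_1 T M f"
  unfolding baire_class_1_def
proof (intro allI impI)
  fix V assume V: "openin (top_of_set M) V"
  have "\<exists>\<D>. countable \<D> \<and> \<Union>\<D> = topspace T \<and>
      (\<forall>D\<in>\<D>. fsigma_in T D \<and> (\<forall>x\<in>D. \<forall>y\<in>D. dist (f x) (f y) \<le> 1 / real (Suc n)))" for n
    by (rule fragmented_countable_fsigma_cover[OF T f(1)]) simp
  then obtain \<D> where \<D>: "\<And>n. countable (\<D> n)" "\<And>n. \<Union>(\<D> n) = topspace T"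
    "\<And>n D. D \<in> \<D> n \<Longrightarrow> fsigma_in T D"
    "\<And>n D x y. D \<in> \<D> n \<Longrightarrow> x \<in> D \<Longrightarrow> y \<in> D \<Longrightarrow> dist (f x) (f y) \<le> 1 / real (Suc n)"
    by metis
  define \<E> where "\<E> = (\<Union>n. {D \<in> \<D> n. f ` D \<subseteq> V})"
  have "countable \<E>"
    unfolding \<E>_def using \<D>(1) by (intro countable_UN) (auto intro: countable_subset[of _ "\<D> _"])
  moreover have "fsigma_in T D" if "D \<in> \<E>" for D
    using that \<D>(3) unfolding \<E>_def by blast
  ultimately have "fsigma_in T (\<Union>\<E>)"
    by (rule fsigma_in_Union)
  moreover have "\<Union>\<E> = {x \<in> topspace T. f x \<in> V}"
  proof
    show "\<Union>\<E> \<subseteq> {x \<in> topspace T. f x \<in> V}"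
      unfolding \<E>_def using \<D>(2) by blast
    show "{x \<in> topspace T. f x \<in> V} \<subseteq> \<Union>\<E>"
    proof safe
      fix x assume x: "x \<in> topspace T" "f x \<in> V"
      obtain e where e: "e > 0" "\<And>y. y \<in> M \<Longrightarrow> dist y (f x) < e \<Longrightarrow> y \<in> V"
        using V x(2) unfolding openin_euclidean_subtopology_iff by blast
      obtain n where n: "1 / real (Suc n) < e"
        using nat_approx_posE[OF e(1)] by blast
      obtain D where D: "D \<in> \<D> n" "x \<in> D"
        using \<D>(2)[of n] x(1) by blast
      \<comment> \<open>The oscillation bound on \<open>D\<close> keeps \<open>f y\<close> within
        \<open>e\<close> of \<open>f x\<close>. Since \<open>V\<close> is open only relative to
        \<open>M\<close>, membership of \<open>f y\<close> in \<open>M\<close> is needed as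
        well.\<close>
      have "f y \<in> V" if y: "y \<in> D" for y
      proof (rule e(2))
        show "f y \<in> M" using f(2) \<D>(2)[of n] D(1) y by blast
        show "dist (f y) (f x) < e" using \<D>(4)[OF D(1) y D(2)] n by linarith
      qed
      then show "x \<in> \<Union>\<E>"
        unfolding \<E>_def using D by blast
    qed
  qed
  ultimately show "fsigma_in T {x \<in> topspace T. f x \<in> V}" by simp
qed

lemma fragmented_Polish_imp_baire_class_1:
  assumes "Polish_topology T" "fragmented_map T f" "f \<in> topspace T \<rightarrow> M"
  shows "baire_class_1 T M f"
  using assms completely_metrizable_imp_metrizable_space separable_metrizable_imp_second_countable
    fragmented_imp_baire_class_1
  unfolding Polish_topology_def by blast

theorem theorem12p16:
  fixes X :: "'a set" and M :: "'b::metric_space set" and f :: "'a \<Rightarrow> 'b"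
  assumes "compact M" and "f \<in> X \<rightarrow> M"
  shows "(\<forall>r. linear_order_on X r \<and> linear_BV X r f \<longrightarrow>
            fragmented_map (linear_interval_topology X r) f \<and>
            (Polish_topology (linear_interval_topology X r) \<longrightarrow>
               baire_class_1 (linear_interval_topology X r) M f)) \<and>
         (\<forall>R. circular_order_on X R \<and> circular_BV X R f \<longrightarrow>
            fragmented_map (circular_interval_topology X R) f \<and>
            (Polish_topology (circular_interval_topology X R) \<longrightarrow>
               baire_class_1 (circular_interval_topology X R) M f))"
  \<comment> \<open>The \<open>topspace\<close> equations turn the assumption on \<open>X\<close>
    into the one on \<open>topspace T\<close> required for Baire class 1.\<close>
  using assms(2) linear_BV_imp_fragmented circular_BV_imp_fragmented
    fragmented_Polish_imp_baire_class_1[of _ f M]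
  by (metis topspace_linear_interval_topology topspace_circular_interval_topology)

end
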